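(* Let $n \geq 1$. For full-rank lattices $L, L' \subset \mathbb{R}^n$ define $$\mathrm{offset}(L,L') = \min\{ r \geq 0 : R(V(L)) \subset N(V(L');r) \text{ for some } R \in SO(n)\},$$ $$d_H(L,L') = \max\{ \mathrm{offset}(L,L'), \mathrm{offset}(L',L)\}.$$ Then $d_H$ is independent of the representation of the lattices (it depends only on the lattices $L, L'$ as point sets, not on chosen bases or unit cells), and it satisfies: (a) $d_H(L,L') \geq 0$, and $d_H(L,L') = 0$ if and only if $L$ and $L'$ are equivalent, i.e. $R(L) = L'$ for some $R \in SO(n)$; (b) $d_H(L,L') = d_H(L',L)$ for all $L, L'$; (c) $d_H(L,L') + d_H(L',L'') \geq d_H(L,L'')$ for all $L, L', L''$; (d) $d_H$ changes continuously under perturbations of the lattices: if $L(B)$ denotes the lattice generated by the columns of an invertible real $n\times n$ matrix $B$, then $(B,B') \mapsto d_H(L(B),L(B'))$ is continuous on $GL_n(\mathbb{R}) \times GL_n(\mathbb{R})$.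
   Context: A (full-rank) lattice in $\mathbb{R}^n$ is the set $L = \{ x_1 u_1 + \dots + x_n u_n : x_i \in \mathbb{Z}\}$ for a basis $u_1,\dots,u_n$ of $\mathbb{R}^n$; in particular $0 \in L$. The Voronoi cell of $L$ is $V(L) = \{ p \in \mathbb{R}^n : d(p,0) \leq d(p,q) \text{ for all } q \in L \setminus \{0\}\}$, where $d$ is the Euclidean distance; it is a convex polytope centrally symmetric about $0$. For $C \subset \mathbb{R}^n$ and $r\ge 0$, $N(C;r) = \{ p \in \mathbb{R}^n : d(p,q) \leq r \text{ for some } q \in C\}$ is the $r$-offset of $C$. $SO(n)$ is the group of real $n \times n$ orthogonal matrices of determinant $1$ (rotations about the origin). Two lattices are called equivalent if one is obtained from the other by an orientation-preserving rigid motion of $\mathbb{R}^n$; for lattices (which contain $0$) this is the same as $R(L)=L'$ for some $R\in SO(n)$. *)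

theory Defs
  imports "HOL-Analysis.Analysis"
begin

definition lattice_of :: "real^'n^'n \<Rightarrow> (real^'n) set" where
  "lattice_of B = {B *v (\<chi> i. of_int (k i)) | k :: 'n \<Rightarrow> int. True}"

definition full_lattice :: "(real^'n) set \<Rightarrow> bool" where
  "full_lattice L \<longleftrightarrow> (\<exists>B::real^'n^'n. invertible B \<and> L = lattice_of B)"

definition SO :: "(real^'n^'n) set" where
  "SO = {R. orthogonal_matrix R \<and> det R = 1}"

definition voronoi :: "(real^'n) set \<Rightarrow> (real^'n) set" where
  "voronoi L = {p. \<forall>q \<in> L - {0}. dist p 0 \<le> dist p q}"

definition offset_nbhd :: "(real^'n) set \<Rightarrow> real \<Rightarrow> (real^'n) set" where
  "offset_nbhd C r = {p. \<exists>q \<in> C. dist p q \<le> r}"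

definition offset_set :: "(real^'n) set \<Rightarrow> (real^'n) set \<Rightarrow> real set" where
  "offset_set L L' = {r. r \<ge> 0 \<and>
     (\<exists>R \<in> SO. (\<lambda>p. R *v p) ` voronoi L \<subseteq> offset_nbhd (voronoi L') r)}"

definition lattice_offset :: "(real^'n) set \<Rightarrow> (real^'n) set \<Rightarrow> real" where
  "lattice_offset L L' = Inf (offset_set L L')"

definition dH :: "(real^'n) set \<Rightarrow> (real^'n) set \<Rightarrow> real" where
  "dH L L' = max (lattice_offset L L') (lattice_offset L' L)"

definition lattice_equiv :: "(real^'n) set \<Rightarrow> (real^'n) set \<Rightarrow> bool" where
  "lattice_equiv L L' \<longleftrightarrow> (\<exists>R \<in> SO. (\<lambda>p. R *v p) ` L = L')"

end

theory Submission
  imports Defs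
begin

text \<open>
  Compactness of \<open>SO(n)\<close> and of Voronoi cells makes the offset a minimum, and composing
  minimizing rotations gives the triangle inequality. If \<open>d\<^sub>H(L,L') = 0\<close>, rotations carry each
  cell into the other; an isometry of a compact set into itself is onto, so one of the rotations
  matches the cells. The cell in turn determines the lattice: it is the polar of the
  inverted lattice \<open>{2q/|q|\<^sup>2}\<close>, so if \<open>V(L) = V(L')\<close>, Krein-Milman puts the extreme points of
  the polar body into both inverted lattices. Hence \<open>G = L \<inter> L'\<close> already has the same cell, and
  a shortest element of a coset \<open>q + G\<close> lies in that cell, which forces \<open>q \<in> G\<close>.
  By the triangle inequality, continuity reduces to \<open>d\<^sub>H(L(C),L(B)) \<rightarrow> 0\<close> as \<open>C \<rightarrow> B\<close>, which holds
  because the cell of either lattice, shrunk by a factor close to \<open>1\<close>, fits into that of the other.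
\<close>

subsection \<open>Lattices\<close>

lemma norm_matrix_vector_mult_le:
  fixes A :: "real^'n^'m"
  shows "norm (A *v x) \<le> norm A * norm x"
proof -
  have "norm (A *v x) = L2_set (\<lambda>i. \<bar>A $ i \<bullet> x\<bar>) UNIV"
    by (simp add: norm_vec_def matrix_vector_mul_component)
  also have "\<dots> \<le> L2_set (\<lambda>i. norm (A $ i) * norm x) UNIV"
    by (intro L2_set_mono) (auto simp: Cauchy_Schwarz_ineq2)
  also have "\<dots> = norm A * norm x"
    by (simp add: L2_set_left_distrib norm_vec_def[of A])
  finally show ?thesis .
qed

lemma lattice_ofI: "B *v (\<chi> i. of_int (k i)) \<in> lattice_of B"
  unfolding lattice_of_def by blast

lemma lattice_of_zero: "0 \<in> lattice_of B"
  using lattice_ofI[of B "\<lambda>_. 0"] by (simp add: zero_vec_def[symmetric])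

lemma lattice_of_diff:
  assumes "x \<in> lattice_of B" "y \<in> lattice_of B"
  shows "x - y \<in> lattice_of B"
proof -
  obtain k l where kl: "x = B *v (\<chi> i. of_int (k i))" "y = B *v (\<chi> i. of_int (l i))"
    using assms by (auto simp: lattice_of_def)
  have "x - y = B *v (\<chi> i. of_int (k i - l i))"
    by (simp add: kl vec_eq_iff flip: matrix_vector_mult_diff_distrib)
       (simp add: matrix_vector_mult_def)
  then show ?thesis by (simp only: lattice_ofI)
qed

lemma invertible_norm_bound:
  fixes B :: "real^'n^'n"
  assumes "invertible B"
  obtains c where "c > 0" "\<And>x. norm x \<le> c * norm (B *v x)"
proof -
  obtain C where C: "C ** B = mat 1" using assms by (auto simp: invertible_def)
  have "norm x \<le> (norm C + 1) * norm (B *v x)" for x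
  proof -
    have "x = C *v (B *v x)" by (simp add: matrix_vector_mul_assoc C)
    then have "norm x \<le> norm C * norm (B *v x)"
      by (metis norm_matrix_vector_mult_le)
    then show ?thesis by (simp add: algebra_simps add_increasing)
  qed
  then show ?thesis by (intro that[of "norm C + 1"]) (auto simp: add_nonneg_pos)
qed

text \<open>The inverse of \<open>B\<close> bounds the integer coordinates of a short lattice point,
  so only the points of a finite integer box qualify.\<close>

lemma finite_lattice_of_norm_le:
  fixes B :: "real^'n^'n"
  assumes "invertible B"
  shows "finite {q \<in> lattice_of B. norm q \<le> r}"
proof -
  obtain c where c: "c > 0" "\<And>x. norm x \<le> c * norm (B *v x)"
    using invertible_norm_bound[OF assms] by blast
  define M where "M = \<lceil>c * r\<rceil>"
  have "{q \<in> lattice_of B. norm q \<le> r}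
          \<subseteq> (\<lambda>k. B *v (\<chi> i. of_int (k i))) ` PiE UNIV (\<lambda>_. {-M..M})"
  proof
    fix q assume "q \<in> {q \<in> lattice_of B. norm q \<le> r}"
    then obtain k where k: "q = B *v (\<chi> i. of_int (k i))" and r: "norm q \<le> r"
      by (auto simp: lattice_of_def)
    have "\<bar>k i\<bar> \<le> M" for i
    proof -
      have "\<bar>real_of_int (k i)\<bar> \<le> norm (\<chi> i. real_of_int (k i))"
        using component_le_norm_cart[of "\<chi> i. real_of_int (k i)" i] by simp
      also have "\<dots> \<le> c * norm q" unfolding k by (rule c)
      also have "\<dots> \<le> c * r" using c r by simp
      finally show ?thesis unfolding M_def by linarith
    qed
    then show "q \<in> (\<lambda>k. B *v (\<chi> i. of_int (k i))) ` PiE UNIV (\<lambda>_. {-M..M})"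
      unfolding k by (intro imageI) (auto simp: PiE_def abs_le_iff minus_le_iff)
  qed
  then show ?thesis by (rule finite_subset) (intro finite_imageI finite_PiE; simp)
qed

text \<open>Rounding the coordinates of \<open>p\<close> down to integers changes each by at most 1,
  hence the coordinate vector by at most \<open>CARD('n)\<close> in norm.\<close>

lemma lattice_of_dense:
  fixes B :: "real^'n^'n"
  assumes "invertible B"
  shows "\<exists>q \<in> lattice_of B. norm (p - q) \<le> norm B * CARD('n)"
proof -
  obtain C where C: "B ** C = mat 1" using assms by (auto simp: invertible_def)
  define x where "x = C *v p"
  define k where "k i = \<lfloor>x $ i\<rfloor>" for i
  have p: "p = B *v x" by (simp add: x_def matrix_vector_mul_assoc C)
  have "norm (x - (\<chi> i. of_int (k i))) \<le> (\<Sum>i\<in>UNIV. \<bar>(x - (\<chi> i. of_int (k i))) $ i\<bar>)"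
    by (rule norm_le_l1_cart)
  also have "\<dots> \<le> (\<Sum>i\<in>(UNIV::'n set). 1)"
    by (intro sum_mono) (simp add: k_def, linarith)
  finally have le: "norm (x - (\<chi> i. of_int (k i))) \<le> CARD('n)" by simp
  have "norm (p - B *v (\<chi> i. of_int (k i))) = norm (B *v (x - (\<chi> i. of_int (k i))))"
    by (simp add: p matrix_vector_mult_diff_distrib)
  also have "\<dots> \<le> norm B * norm (x - (\<chi> i. of_int (k i)))"
    by (rule norm_matrix_vector_mult_le)
  also have "\<dots> \<le> norm B * CARD('n)" by (intro mult_left_mono le) simp
  finally show ?thesis using lattice_ofI by blast
qed

subsection \<open>Voronoi cells\<close>

lemma voronoi_inner: "voronoi L = {p. \<forall>q\<in>L. 2 * (p \<bullet> q) \<le> q \<bullet> q}"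
proof -
  have "dist p 0 \<le> dist p q \<longleftrightarrow> 2 * (p \<bullet> q) \<le> q \<bullet> q" for p q :: "real^'n"
    by (simp add: dist_norm norm_le inner_diff inner_commute algebra_simps)
  then show ?thesis unfolding voronoi_def by fastforce
qed

lemma zero_in_voronoi: "0 \<in> voronoi L"
  by (simp add: voronoi_inner)

text \<open>A point of the cell is no farther from 0 than from the lattice point found by rounding.
  The bound depends on \<open>B\<close> only through \<open>norm B\<close>, which makes it uniform
  for nearby matrices.\<close>

lemma norm_voronoi_le:
  fixes B :: "real^'n^'n"
  assumes "invertible B" "p \<in> voronoi (lattice_of B)"
  shows "norm p \<le> norm B * CARD('n)"
proof -
  obtain q where q: "q \<in> lattice_of B" "norm (p - q) \<le> norm B * CARD('n)"
    using lattice_of_dense[OF assms(1)] by blast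
  show ?thesis
  proof (cases "q = 0")
    case False
    then have "norm p \<le> norm (p - q)"
      using assms(2) q(1) by (auto simp: voronoi_def dist_norm)
    then show ?thesis using q(2) by linarith
  qed (use q in simp)
qed

lemma compact_voronoi:
  assumes "full_lattice L"
  shows "compact (voronoi L)"
proof -
  obtain B where B: "invertible B" "L = lattice_of B"
    using assms by (auto simp: full_lattice_def)
  have "bounded (voronoi L)"
    unfolding bounded_iff using norm_voronoi_le[OF B(1)] B(2) by blast
  moreover have "voronoi L = (\<Inter>q\<in>L. {p. p \<bullet> (2 *\<^sub>R q) \<le> q \<bullet> q})"
    by (auto simp: voronoi_inner)
  then have "closed (voronoi L)"
    by (simp only:) (intro closed_INT ballI closed_Collect_le continuous_intros)
  ultimately show ?thesis by (simp add: compact_eq_bounded_closed)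
qed

lemma lattice_subset_if_voronoi_subset:
  assumes "full_lattice L" "G \<subseteq> L" "0 \<in> G"
    and diff: "\<And>x y. x \<in> G \<Longrightarrow> y \<in> G \<Longrightarrow> x - y \<in> G"
    and V: "voronoi G \<subseteq> voronoi L"
  shows "L \<subseteq> G"
proof
  fix q assume "q \<in> L"
  obtain B where B: "invertible B" "L = lattice_of B"
    using assms(1) by (auto simp: full_lattice_def)
  \<comment> \<open>These are the elements of the coset of \<open>q\<close> modulo \<open>G\<close>
    that are no longer than \<open>q\<close>; the norm bound makes the set finite, so a shortest
    element exists.\<close>
  define S where "S = {x \<in> L. norm x \<le> norm q \<and> q - x \<in> G}"
  have "finite S"
    by (rule finite_subset[OF _ finite_lattice_of_norm_le[OF B(1), of "norm q"]])
       (auto simp: S_def B)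
  moreover have "q \<in> S" using \<open>q \<in> L\<close> \<open>0 \<in> G\<close> by (simp add: S_def)
  ultimately obtain x where x: "x \<in> S" "\<And>y. y \<in> S \<Longrightarrow> norm x \<le> norm y"
    using arg_min_if_finite[of S norm] by (metis empty_iff linorder_not_le)
  have "norm x \<le> norm (x - g)" if "g \<in> G" for g
  proof (rule ccontr)
    assume "\<not> norm x \<le> norm (x - g)"
    moreover have "x - g \<in> L"
      using x(1) that \<open>G \<subseteq> L\<close> lattice_of_diff B(2) by (auto simp: S_def)
    moreover have "q - (x - g) \<in> G"
      using diff[of "q - x" "0 - g"] diff[of 0 g] x(1) that \<open>0 \<in> G\<close> by (simp add: S_def algebra_simps)
    ultimately have "x - g \<in> S" using x(1) by (auto simp: S_def)
    then show False using x(2) \<open>\<not> norm x \<le> norm (x - g)\<close> by blast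
  qed
  then have "x \<in> voronoi G" by (simp add: voronoi_def dist_norm)
  then have "x \<in> voronoi L" using V by blast
  moreover have "x \<in> L" using x(1) by (simp add: S_def)
  \<comment> \<open>A nonzero \<open>x\<close> in \<open>L\<close> lies closer to itself than to 0,
    so it cannot lie in the cell of \<open>L\<close>.\<close>
  ultimately have "x = 0" by (force simp: voronoi_def)
  then show "q \<in> G" using x(1) by (simp add: S_def)
qed

section \<open>Polar duality and recovery of a lattice from its cell\<close>

text \<open>Since \<open>2 / 0 = 0\<close>, the lattice point \<open>0\<close> is sent to \<open>0\<close>.\<close>

definition polar_points :: "(real^'n) set \<Rightarrow> (real^'n) set" where
  "polar_points L = insert 0 ((\<lambda>q. (2 / (q \<bullet> q)) *\<^sub>R q) ` L)"

lemma voronoi_polar: "voronoi L = {p. \<forall>s\<in>polar_points L. p \<bullet> s \<le> 1}"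
proof -
  have "2 * (p \<bullet> q) \<le> q \<bullet> q \<longleftrightarrow> p \<bullet> ((2 / (q \<bullet> q)) *\<^sub>R q) \<le> 1" for p q :: "real^'n"
    by (cases "q = 0") (simp_all add: divide_simps)
  then show ?thesis by (auto simp: voronoi_inner polar_points_def)
qed

text \<open>Inversion sends long lattice vectors close to 0, so any open set containing 0 already
  covers all but finitely many of the points.\<close>

lemma compact_polar_points:
  assumes "full_lattice L"
  shows "compact (polar_points L)"
proof (rule compactI)
  fix C assume C: "\<forall>t\<in>C. open t" "polar_points L \<subseteq> \<Union>C"
  obtain B where B: "invertible B" "L = lattice_of B"
    using assms by (auto simp: full_lattice_def)
  obtain U where U: "U \<in> C" "0 \<in> U" using C(2) by (auto simp: polar_points_def)
  then obtain e where e: "e > 0" "ball 0 e \<subseteq> U"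
    using C(1) open_contains_ball by blast
  \<comment> \<open>An inverted vector has norm \<open>2 / norm q\<close>, so beyond the cutoff
    \<open>2 / e\<close> it falls into the ball of radius \<open>e\<close>.\<close>
  define F where "F = (\<lambda>q. (2 / (q \<bullet> q)) *\<^sub>R q) ` {q \<in> L. norm q \<le> 2 / e}"
  have "finite F"
    unfolding F_def B(2) using finite_lattice_of_norm_le[OF B(1)] by simp
  moreover have "\<forall>s\<in>F. \<exists>t\<in>C. s \<in> t" using C(2) by (auto simp: F_def polar_points_def)
  then obtain g where g: "\<And>s. s \<in> F \<Longrightarrow> g s \<in> C \<and> s \<in> g s" by metis
  moreover have "polar_points L \<subseteq> U \<union> F"
  proof
    fix s assume "s \<in> polar_points L"
    then consider "s = 0" | q where "q \<in> L" "s = (2 / (q \<bullet> q)) *\<^sub>R q"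
      by (auto simp: polar_points_def)
    then show "s \<in> U \<union> F"
    proof cases
      case 2
      show ?thesis
      proof (cases "norm q \<le> 2 / e")
        case False
        then have "norm q > 0" using e(1) by (smt (verit) divide_pos_pos)
        then have "norm s = 2 / norm q"
          by (simp add: 2 power2_norm_eq_inner[symmetric] power2_eq_square)
        also have "\<dots> < e" using False e(1) \<open>norm q > 0\<close> by (simp add: field_simps)
        finally show ?thesis using e(2) by (auto simp: subset_iff)
      qed (use 2 in \<open>auto simp: F_def\<close>)
    qed (use U in simp)
  qed
  ultimately show "\<exists>C'\<subseteq>C. finite C' \<and> polar_points L \<subseteq> \<Union>C'"
    using U by (intro exI[of _ "insert U (g ` F)"]) fastforce
qed

text \<open>This is the bipolar argument: a hyperplane separating a point of
  \<open>polar_points L'\<close> from the hull rescales to a point of \<open>voronoi L\<close> that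
  violates an inequality of \<open>voronoi L'\<close>.\<close>

lemma convex_hull_polar_points_subset:
  assumes "full_lattice L" "voronoi L \<subseteq> voronoi L'"
  shows "convex hull polar_points L' \<subseteq> convex hull polar_points L"
proof (rule hull_minimal)
  let ?K = "convex hull polar_points L"
  have "0 \<in> ?K" by (simp add: hull_inc polar_points_def)
  show "polar_points L' \<subseteq> ?K"
  proof (rule ccontr)
    assume "\<not> polar_points L' \<subseteq> ?K"
    then obtain s where s: "s \<in> polar_points L'" "s \<notin> ?K" by blast
    have "closed ?K" by (simp add: assms(1) compact_polar_points compact_convex_hull compact_imp_closed)
    then obtain a b where ab: "a \<bullet> s < b" "\<And>x. x \<in> ?K \<Longrightarrow> a \<bullet> x > b"
      using separating_hyperplane_closed_point[OF convex_convex_hull _ s(2)] by blast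
    have "b < 0" using ab(2)[OF \<open>0 \<in> ?K\<close>] by simp
    \<comment> \<open>Since \<open>b\<close> is negative, dividing by it turns
      \<open>a \<bullet> x > b\<close> into an upper bound by 1.\<close>
    have "(1 / b) *\<^sub>R a \<in> voronoi L"
      using ab(2) \<open>b < 0\<close> by (force simp: voronoi_polar divide_simps hull_inc less_imp_le)
    then have "(1 / b) *\<^sub>R a \<in> voronoi L'" using assms(2) by blast
    then have "(1 / b) * (a \<bullet> s) \<le> 1" using s(1) by (auto simp: voronoi_polar)
    then show False using ab(1) \<open>b < 0\<close> by (simp add: divide_simps)
  qed
qed (rule convex_convex_hull)

text \<open>The map is an involution, also at 0, where it takes the value 0.\<close>

lemma inversion_inj:
  fixes q r :: "'a::real_inner"
  assumes "(2 / (q \<bullet> q)) *\<^sub>R q = (2 / (r \<bullet> r)) *\<^sub>R r"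
  shows "q = r"
proof -
  have inv: "(2 / (s \<bullet> s)) *\<^sub>R s = x" if "s = (2 / (x \<bullet> x)) *\<^sub>R x" for s x :: 'a
    using that by (cases "x = 0") (simp_all add: divide_simps)
  show ?thesis using inv[OF refl, of q] inv[OF refl, of r] assms by simp
qed

lemma voronoi_inj:
  assumes L: "full_lattice L" "full_lattice L'" and V: "voronoi L = voronoi L'"
  shows "L = L'"
proof -
  let ?K = "convex hull polar_points L"
  have K: "?K = convex hull polar_points L'"
    using convex_hull_polar_points_subset L V by (metis subset_antisym order_refl)
  \<comment> \<open>Extreme points of a convex hull belong to every generating set, and
    \<open>?K\<close> is generated by the polar points of either lattice.\<close>
  have "{x. x extreme_point_of ?K} \<subseteq> polar_points L \<inter> polar_points L'"
    using extreme_point_of_convex_hull K by (metis (mono_tags, lifting) Int_iff mem_Collect_eq subsetI)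
  also have "\<dots> \<subseteq> polar_points (L \<inter> L')"
    by (auto simp: polar_points_def dest: inversion_inj)
  finally have "?K \<subseteq> convex hull polar_points (L \<inter> L')"
    using Krein_Milman_Minkowski[of ?K] L(1)
    by (metis compact_convex_hull compact_polar_points convex_convex_hull hull_mono)
  \<comment> \<open>The inequalities defining the cell are linear in \<open>s\<close>, so they pass
    from the generators to their hull, which contains \<open>polar_points L\<close>.\<close>
  moreover have "convex hull polar_points (L \<inter> L') \<subseteq> {s. p \<bullet> s \<le> 1}" if "p \<in> voronoi (L \<inter> L')" for p
    using that by (intro hull_minimal convex_halfspace_le) (auto simp: voronoi_polar)
  ultimately have le: "voronoi (L \<inter> L') \<subseteq> voronoi L"
    by (auto simp: voronoi_polar[of L] subset_iff hull_inc)
  have "0 \<in> L \<inter> L'" "\<And>x y. x \<in> L \<inter> L' \<Longrightarrow> y \<in> L \<inter> L' \<Longrightarrow> x - y \<in> L \<inter> L'"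
    using L lattice_of_zero lattice_of_diff by (auto simp: full_lattice_def)
  note G = this
  have "L \<subseteq> L \<inter> L'"
    by (rule lattice_subset_if_voronoi_subset[OF L(1) _ G le]) simp
  moreover have "L' \<subseteq> L \<inter> L'"
    by (rule lattice_subset_if_voronoi_subset[OF L(2) _ G]) (use le V in simp_all)
  ultimately show ?thesis by blast
qed

subsection \<open>Rotations\<close>

lemma SO_mat_1: "mat 1 \<in> SO"
  by (simp add: SO_def orthogonal_matrix_id)

lemma SO_mult: "R \<in> SO \<Longrightarrow> S \<in> SO \<Longrightarrow> R ** S \<in> SO"
  by (simp add: SO_def orthogonal_matrix_mul det_mul)

lemma SO_transpose: "R \<in> SO \<Longrightarrow> transpose R \<in> SO"
  by (simp add: SO_def det_transpose)

lemma SO_transpose_cancel: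
  assumes "R \<in> SO"
  shows "transpose R *v (R *v x) = x" "R *v (transpose R *v x) = x"
  using assms by (simp_all add: SO_def orthogonal_matrix_def matrix_vector_mul_assoc del: transpose_matrix_vector)

lemma SO_inner: "R \<in> SO \<Longrightarrow> (R *v x) \<bullet> (R *v y) = x \<bullet> y"
  by (metis SO_transpose_cancel(1) dot_lmul_matrix transpose_transpose vector_transpose_matrix)

lemma SO_dist: "R \<in> SO \<Longrightarrow> dist (R *v x) (R *v y) = dist x y"
  by (simp add: dist_norm norm_eq_sqrt_inner SO_inner flip: matrix_vector_mult_diff_distrib)

text \<open>Rows of an orthogonal matrix are unit vectors, which gives boundedness; the defining
  equations are polynomial in the entries, which gives closedness.\<close>

lemma compact_SO: "compact (SO :: (real^'n^'n) set)"
proof -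
  have "norm R \<le> CARD('n)" if "R \<in> SO" for R :: "real^'n^'n"
  proof -
    have "norm R \<le> (\<Sum>i\<in>UNIV. norm (R $ i))"
      unfolding norm_vec_def[of R] by (rule L2_set_le_sum) simp
    also have "\<dots> = (\<Sum>i\<in>(UNIV::'n set). 1)"
      using that by (intro sum.cong) (auto simp: SO_def orthogonal_matrix_orthonormal_rows row_def)
    finally show ?thesis by simp
  qed
  then have "bounded (SO :: (real^'n^'n) set)" unfolding bounded_iff by blast
  moreover have "closed ({R. transpose R ** R = mat 1} \<inter> {R::real^'n^'n. det R = 1})"
    unfolding det_def transpose_def matrix_matrix_mult_def
    by (intro closed_Int closed_Collect_eq continuous_intros)
  then have "closed (SO :: (real^'n^'n) set)"
    by (simp add: SO_def orthogonal_matrix Collect_conj_eq)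
  ultimately show ?thesis by (simp add: compact_eq_bounded_closed)
qed

lemma voronoi_rotate:
  assumes "R \<in> SO"
  shows "voronoi ((*v) R ` L) = (*v) R ` voronoi L"
proof (intro set_eqI iffI)
  fix p assume p: "p \<in> voronoi ((*v) R ` L)"
  have "2 * ((transpose R *v p) \<bullet> q) \<le> q \<bullet> q" if "q \<in> L" for q
  proof -
    have "(transpose R *v p) \<bullet> q = p \<bullet> (R *v q)"
      using SO_inner[OF assms, of "transpose R *v p" q] by (simp add: SO_transpose_cancel[OF assms] del: transpose_matrix_vector)
    then show ?thesis using p that by (auto simp: voronoi_inner SO_inner[OF assms])
  qed
  then have "transpose R *v p \<in> voronoi L" by (simp add: voronoi_inner)
  then show "p \<in> (*v) R ` voronoi L"
    by (metis SO_transpose_cancel(2)[OF assms] imageI)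
qed (auto simp: voronoi_inner SO_inner[OF assms])

lemma full_lattice_rotate:
  assumes "R \<in> SO" "full_lattice L"
  shows "full_lattice ((*v) R ` L)"
proof -
  obtain B where B: "invertible B" "L = lattice_of B"
    using assms by (auto simp: full_lattice_def)
  have "(*v) R ` L = lattice_of (R ** B)"
    unfolding B lattice_of_def by (force simp: matrix_vector_mul_assoc)
  moreover have "invertible (R ** B)"
    using assms B by (intro invertible_mult) (auto simp: invertible_det_nz SO_def)
  ultimately show ?thesis by (auto simp: full_lattice_def)
qed

lemma lattice_equiv_sym:
  assumes "lattice_equiv L L'"
  shows "lattice_equiv L' L"
proof -
  obtain R where R: "R \<in> SO" "(*v) R ` L = L'" using assms by (auto simp: lattice_equiv_def)
  have "(*v) (transpose R) ` L' = L"
    unfolding R(2)[symmetric] by (simp add: image_image SO_transpose_cancel[OF R(1)] del: transpose_matrix_vector)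
  then show ?thesis using SO_transpose[OF R(1)] unfolding lattice_equiv_def by blast
qed

text \<open>If \<open>x\<close> were missed, it would have some distance \<open>e > 0\<close> from
  the image. Its iterates would then be pairwise \<open>e\<close>-separated, leaving no convergent
  subsequence.\<close>

lemma isometry_compact_self_surj:
  fixes f :: "'a::metric_space \<Rightarrow> 'a"
  assumes "compact V" and V: "f ` V \<subseteq> V"
    and iso: "\<And>x y. x \<in> V \<Longrightarrow> y \<in> V \<Longrightarrow> dist (f x) (f y) = dist x y"
  shows "f ` V = V"
proof (rule ccontr)
  assume "f ` V \<noteq> V"
  then obtain x where x: "x \<in> V" "x \<notin> f ` V" using V by blast
  have "continuous_on V f" unfolding continuous_on_iff using iso by metis
  then have "closed (f ` V)" using \<open>compact V\<close> by (simp add: compact_continuous_image compact_imp_closed)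
  then obtain e where "e > 0" "ball x e \<subseteq> - (f ` V)"
    using x(2) open_contains_ball[of "- (f ` V)"] by blast
  then have e: "e > 0" "\<And>y. y \<in> f ` V \<Longrightarrow> e \<le> dist x y"
    by (auto simp: subset_iff not_less[symmetric])
  define s where "s n = (f ^^ n) x" for n
  have sV: "s n \<in> V" for n
    by (induction n) (use x V in \<open>auto simp: s_def\<close>)
  have shift: "dist (s m) (s (m + k)) = dist x (s k)" for m k
  proof (induction m)
    case (Suc m)
    have "dist (s (Suc m)) (s (Suc m + k)) = dist (f (s m)) (f (s (m + k)))" by (simp add: s_def)
    then show ?case using iso[OF sV sV] Suc by simp
  qed (simp add: s_def)
  have sep: "e \<le> dist (s m) (s n)" if mn: "m < n" for m n
  proof -
    obtain k where k: "n = m + Suc k" using less_imp_Suc_add[OF mn] by auto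
    have "s (Suc k) \<in> f ` V" using sV[of k] by (simp add: s_def)
    then show ?thesis using shift[of m "Suc k"] e(2) by (simp only: k)
  qed
  obtain l r where "strict_mono (r :: nat \<Rightarrow> nat)" "(s \<circ> r) \<longlonglongrightarrow> l"
    using compact_imp_seq_compact[OF \<open>compact V\<close>] sV by (metis seq_compactE)
  moreover from this have "Cauchy (s \<circ> r)" by (simp add: LIMSEQ_imp_Cauchy)
  ultimately obtain N where "\<And>m n. m \<ge> N \<Longrightarrow> n \<ge> N \<Longrightarrow> dist (s (r m)) (s (r n)) < e"
    using e(1) unfolding Cauchy_def by (metis comp_apply)
  then have "dist (s (r N)) (s (r (Suc N))) < e" by simp
  moreover have "r N < r (Suc N)" using \<open>strict_mono r\<close> by (simp add: strict_mono_def)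
  ultimately show False using sep by fastforce
qed

subsection \<open>The offset distance\<close>

text \<open>Nearest points exist in a closed set, so the existential becomes an inequality between
  continuous functions, as needed for closedness.\<close>

lemma offset_nbhd_infdist:
  assumes "closed C" "C \<noteq> {}"
  shows "offset_nbhd C r = {p. infdist p C \<le> r}"
  unfolding offset_nbhd_def
  using infdist_attains_inf[OF assms] infdist_le2 by (metis (no_types, opaque_lifting))

lemma offset_set_nonempty:
  assumes "full_lattice L"
  shows "offset_set L L' \<noteq> {}"
proof -
  obtain M where M: "M > 0" "\<And>p. p \<in> voronoi L \<Longrightarrow> norm p \<le> M"
    using compact_imp_bounded[OF compact_voronoi[OF assms]] bounded_pos by blast
  then have "(*v) (mat 1) ` voronoi L \<subseteq> offset_nbhd (voronoi L') M"
    using zero_in_voronoi[of L'] by (force simp: offset_nbhd_def)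
  then have "M \<in> offset_set L L'"
    unfolding offset_set_def using SO_mat_1 M(1) by (auto intro!: bexI[of _ "mat 1"])
  then show ?thesis by blast
qed

lemma closed_offset_set:
  fixes L L' :: "(real^'n) set"
  assumes "full_lattice L'"
  shows "closed (offset_set L L')"
proof -
  let ?V = "voronoi L" and ?V' = "voronoi L'"
  have V': "closed ?V'" "?V' \<noteq> {}"
    using assms zero_in_voronoi by (auto intro: compact_imp_closed compact_voronoi)
  let ?T = "\<Inter>p\<in>?V. {z :: (real^'n^'n) \<times> real. infdist (fst z *v p) ?V' \<le> snd z}"
  have "closed ?T"
    unfolding matrix_vector_mult_def
    by (intro closed_INT ballI closed_Collect_le continuous_intros)
  \<comment> \<open>Projecting a closed set of pairs along the compact factor \<open>SO\<close>
    keeps it closed.\<close>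
  then have "closed {r. \<exists>R. R \<in> SO \<and> (R, r) \<in> ?T}"
    by (rule closed_compact_projection[OF compact_SO])
  moreover have "offset_set L L' = {0..} \<inter> {r. \<exists>R. R \<in> SO \<and> (R, r) \<in> ?T}"
    by (auto simp: offset_set_def offset_nbhd_infdist[OF V'])
  ultimately show ?thesis by (simp add: closed_Int)
qed

lemma bdd_below_offset_set: "bdd_below (offset_set L L')"
  by (rule bdd_belowI[of _ 0]) (simp add: offset_set_def)

text \<open>This justifies \<open>Inf\<close> in place of a minimum and supplies optimal rotations
  for the arguments below.\<close>

lemma lattice_offset_attained:
  assumes "full_lattice L" "full_lattice L'"
  shows "lattice_offset L L' \<in> offset_set L L'"
  unfolding lattice_offset_def
  by (intro closed_contains_Inf offset_set_nonempty bdd_below_offset_set closed_offset_set assms)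

lemma lattice_offset_nonneg:
  assumes "full_lattice L" "full_lattice L'"
  shows "0 \<le> lattice_offset L L'"
  using lattice_offset_attained[OF assms] by (simp add: offset_set_def)

lemma lattice_offset_le:
  assumes "r \<in> offset_set L L'"
  shows "lattice_offset L L' \<le> r"
  unfolding lattice_offset_def by (rule cInf_lower[OF assms bdd_below_offset_set])

text \<open>Compose the two optimal rotations: the second is an isometry, so it preserves the error
  made by the first.\<close>

lemma lattice_offset_triangle:
  assumes "full_lattice L" "full_lattice L'" "full_lattice L''"
  shows "lattice_offset L L'' \<le> lattice_offset L L' + lattice_offset L' L''"
proof (rule lattice_offset_le)
  obtain R where R: "R \<in> SO" "(*v) R ` voronoi L \<subseteq> offset_nbhd (voronoi L') (lattice_offset L L')"
    using lattice_offset_attained[OF assms(1,2)] by (auto simp: offset_set_def)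
  obtain S where S: "S \<in> SO" "(*v) S ` voronoi L' \<subseteq> offset_nbhd (voronoi L'') (lattice_offset L' L'')"
    using lattice_offset_attained[OF assms(2,3)] by (auto simp: offset_set_def)
  have "(*v) (S ** R) ` voronoi L \<subseteq> offset_nbhd (voronoi L'') (lattice_offset L L' + lattice_offset L' L'')"
  proof clarify
    fix p assume "p \<in> voronoi L"
    then obtain q where q: "q \<in> voronoi L'" "dist (R *v p) q \<le> lattice_offset L L'"
      using R(2) by (auto simp: offset_nbhd_def)
    then obtain t where t: "t \<in> voronoi L''" "dist (S *v q) t \<le> lattice_offset L' L''"
      using S(2) by (auto simp: offset_nbhd_def)
    have "dist (S *v (R *v p)) t \<le> dist (S *v (R *v p)) (S *v q) + dist (S *v q) t"
      by (rule dist_triangle)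
    also have "\<dots> \<le> lattice_offset L L' + lattice_offset L' L''"
      using q t by (simp add: SO_dist[OF S(1)])
    finally show "(S ** R) *v p \<in> offset_nbhd (voronoi L'') (lattice_offset L L' + lattice_offset L' L'')"
      using t(1) by (auto simp: offset_nbhd_def matrix_vector_mul_assoc)
  qed
  then show "lattice_offset L L' + lattice_offset L' L'' \<in> offset_set L L''"
    using SO_mult[OF S(1) R(1)] lattice_offset_nonneg[OF assms(1,2)] lattice_offset_nonneg[OF assms(2,3)]
    by (auto simp: offset_set_def)
qed

lemma dH_commute: "dH L L' = dH L' L"
  by (simp add: dH_def max.commute)

lemma dH_nonneg:
  assumes "full_lattice L" "full_lattice L'"
  shows "0 \<le> dH L L'"
  using lattice_offset_nonneg[OF assms] by (simp add: dH_def)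

lemma dH_triangle:
  assumes "full_lattice L" "full_lattice L'" "full_lattice L''"
  shows "dH L L'' \<le> dH L L' + dH L' L''"
  using lattice_offset_triangle[OF assms] lattice_offset_triangle[OF assms(3,2,1)]
  unfolding dH_def by linarith

lemma lattice_offset_equiv:
  assumes "full_lattice L" "full_lattice L'" "lattice_equiv L L'"
  shows "lattice_offset L L' = 0"
proof -
  obtain R where R: "R \<in> SO" "(*v) R ` L = L'" using assms by (auto simp: lattice_equiv_def)
  have "voronoi L' \<subseteq> offset_nbhd (voronoi L') 0" by (auto simp: offset_nbhd_def)
  then have "(*v) R ` voronoi L \<subseteq> offset_nbhd (voronoi L') 0"
    using voronoi_rotate[OF R(1), of L] R(2) by simp
  then have "0 \<in> offset_set L L'" using R(1) by (auto simp: offset_set_def)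
  then show ?thesis
    using lattice_offset_le lattice_offset_nonneg[OF assms(1,2)] by (metis order_antisym)
qed

lemma lattice_offset_zero_rotation:
  assumes "full_lattice L" "full_lattice L'" "lattice_offset L L' = 0"
  obtains R where "R \<in> SO" "(*v) R ` voronoi L \<subseteq> voronoi L'"
proof -
  have "0 \<in> offset_set L L'" using lattice_offset_attained assms by metis
  then obtain R where "R \<in> SO" "(*v) R ` voronoi L \<subseteq> offset_nbhd (voronoi L') 0"
    by (auto simp: offset_set_def)
  moreover have "offset_nbhd (voronoi L') 0 = voronoi L'" by (auto simp: offset_nbhd_def)
  ultimately show ?thesis using that by metis
qed

lemma dH_eq_0_iff:
  assumes L: "full_lattice L" "full_lattice L'"
  shows "dH L L' = 0 \<longleftrightarrow> lattice_equiv L L'"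
proof
  assume "lattice_equiv L L'"
  then show "dH L L' = 0"
    using lattice_offset_equiv L lattice_equiv_sym by (metis dH_def max.idem)
next
  assume "dH L L' = 0"
  then have "lattice_offset L L' = 0" "lattice_offset L' L = 0"
    using lattice_offset_nonneg[OF L] lattice_offset_nonneg[OF L(2,1)] by (auto simp: dH_def max_def split: if_splits)
  then obtain R S where R: "R \<in> SO" "(*v) R ` voronoi L \<subseteq> voronoi L'"
    and S: "S \<in> SO" "(*v) S ` voronoi L' \<subseteq> voronoi L"
    using lattice_offset_zero_rotation L by metis
  have "(*v) (S ** R) ` voronoi L = (*v) S ` ((*v) R ` voronoi L)"
    by (simp add: image_image matrix_vector_mul_assoc)
  then have sub: "(*v) (S ** R) ` voronoi L \<subseteq> (*v) S ` voronoi L'" using R(2) by auto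
  \<comment> \<open>\<open>S ** R\<close> maps the compact cell isometrically into itself, hence
    onto. This squeezes the rotated cell of \<open>L'\<close> between two copies of
    \<open>voronoi L\<close>.\<close>
  have "(*v) (S ** R) ` voronoi L = voronoi L"
    using sub S(2) compact_voronoi[OF L(1)] SO_dist[OF SO_mult[OF S(1) R(1)]]
    by (intro isometry_compact_self_surj) auto
  then have "voronoi ((*v) S ` L') = voronoi L"
    using sub S by (simp add: voronoi_rotate subset_antisym)
  then have "(*v) S ` L' = L"
    using voronoi_inj full_lattice_rotate S(1) L by blast
  then have "lattice_equiv L' L" using S(1) by (auto simp: lattice_equiv_def)
  then show "lattice_equiv L L'" by (rule lattice_equiv_sym)
qed

subsection \<open>Continuity\<close>

text \<open>A nonzero integer vector has norm at least 1.\<close>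

lemma lattice_of_norm_ge:
  assumes "\<And>x. norm x \<le> k * norm (A *v x)" "q \<in> lattice_of A" "q \<noteq> 0"
  shows "1 \<le> k * norm q"
proof -
  obtain l where l: "q = A *v (\<chi> i. of_int (l i))" using assms(2) by (auto simp: lattice_of_def)
  then obtain i where i: "l i \<noteq> 0"
    using assms(3) by (metis (mono_tags, lifting) matrix_vector_mult_0_right of_int_0 vec_lambda_unique zero_index)
  then have "1 \<le> \<bar>real_of_int (l i)\<bar>" by linarith
  also have "\<dots> \<le> norm (\<chi> i. real_of_int (l i))"
    using component_le_norm_cart[of "\<chi> i. real_of_int (l i)" i] by simp
  also have "\<dots> \<le> k * norm q" unfolding l by (rule assms)
  finally show ?thesis .
qed

text \<open>A point \<open>p\<close> of the cell of \<open>B\<close> satisfies the inequalities for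
  \<open>A\<close> up to a factor \<open>c\<close> close to 1. Thus \<open>p / c\<close> lies in the
  cell of \<open>A\<close>, at distance at most \<open>M * (c - 1)\<close> from
  \<open>p\<close>.\<close>

lemma voronoi_subset_offset_nbhd:
  fixes A B :: "real^'n^'n"
  assumes k: "0 \<le> k" "\<And>x. norm x \<le> k * norm (A *v x)"
    and M: "0 \<le> M" "\<And>p. p \<in> voronoi (lattice_of B) \<Longrightarrow> norm p \<le> M"
  defines "e \<equiv> k * norm (A - B)"
  shows "voronoi (lattice_of B) \<subseteq>
    offset_nbhd (voronoi (lattice_of A)) (M * (2 * e + e\<^sup>2 + 2 * M * k * e))"
proof
  fix p assume p: "p \<in> voronoi (lattice_of B)"
  \<comment> \<open>This is \<open>(1 + e)\<^sup>2 + 2 * M * k * e\<close>: the square compares the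
    lengths of corresponding lattice points \<open>b\<close> and \<open>a\<close>, the rest is the
    cost of replacing \<open>p \<bullet> a\<close> by \<open>p \<bullet> b\<close>.\<close>
  define c where "c = 1 + (2 * e + e\<^sup>2 + 2 * M * k * e)"
  have "0 \<le> e" using k by (simp add: e_def)
  then have c: "1 \<le> c" using k M by (simp add: c_def)
  have "2 * (p \<bullet> a) \<le> c * (a \<bullet> a)" if a: "a \<in> lattice_of A" for a
  proof (cases "a = 0")
    case False
    obtain l where l: "a = A *v (\<chi> i. of_int (l i))" using a by (auto simp: lattice_of_def)
    define x :: "real^'n" where "x = (\<chi> i. of_int (l i))"
    define b where "b = B *v x"
    have ab: "norm (a - b) \<le> e * norm a"
    proof -
      have "norm (a - b) = norm ((A - B) *v x)"
        by (simp add: l b_def x_def matrix_vector_mult_diff_rdistrib)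
      also have "\<dots> \<le> norm (A - B) * norm x" by (rule norm_matrix_vector_mult_le)
      also have "\<dots> \<le> norm (A - B) * (k * norm a)"
        using k(2)[of x] by (intro mult_left_mono) (simp_all add: l x_def)
      finally show ?thesis by (simp add: e_def mult_ac)
    qed
    have "norm b \<le> norm a + norm (a - b)" by (metis norm_minus_commute norm_triangle_sub)
    then have "norm b \<le> (1 + e) * norm a" using ab by (simp add: algebra_simps)
    then have "(norm b)\<^sup>2 \<le> ((1 + e) * norm a)\<^sup>2" by (intro power_mono) auto
    then have bb: "b \<bullet> b \<le> (1 + e)\<^sup>2 * (a \<bullet> a)"
      by (simp add: power_mult_distrib power2_norm_eq_inner)
    have "p \<bullet> (a - b) \<le> norm p * norm (a - b)" by (rule norm_cauchy_schwarz)
    also have "\<dots> \<le> M * (e * norm a)" using M p ab by (intro mult_mono) auto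
    \<comment> \<open>The factor \<open>k * norm a\<close> is at least 1; inserting it makes the
      error quadratic in \<open>a\<close>, so it can be absorbed into
      \<open>c * (a \<bullet> a)\<close>.\<close>
    also have "\<dots> \<le> M * (e * norm a) * (k * norm a)"
      using mult_left_mono[OF lattice_of_norm_ge[OF k(2) a False], of "M * (e * norm a)"] M(1) \<open>0 \<le> e\<close>
      by simp
    also have "\<dots> = M * k * e * (a \<bullet> a)"
      by (simp add: power2_norm_eq_inner[symmetric] power2_eq_square)
    finally have "2 * (p \<bullet> a) \<le> 2 * (p \<bullet> b) + 2 * M * k * e * (a \<bullet> a)"
      by (simp add: inner_diff_right)
    moreover have "2 * (p \<bullet> b) \<le> b \<bullet> b"
      using p lattice_ofI[of B l] by (auto simp: voronoi_inner b_def x_def)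
    ultimately have "2 * (p \<bullet> a) \<le> (1 + e)\<^sup>2 * (a \<bullet> a) + 2 * M * k * e * (a \<bullet> a)"
      using bb by linarith
    also have "\<dots> = c * (a \<bullet> a)" by (simp add: c_def power2_eq_square algebra_simps)
    finally show ?thesis .
  qed simp
  then have "(1 / c) *\<^sub>R p \<in> voronoi (lattice_of A)"
    using c by (simp add: voronoi_inner divide_simps mult.commute)
  moreover have "dist p ((1 / c) *\<^sub>R p) \<le> M * (c - 1)"
  proof -
    have "p - (1 / c) *\<^sub>R p = (1 - 1 / c) *\<^sub>R p" by (simp add: scaleR_left_diff_distrib)
    then have "dist p ((1 / c) *\<^sub>R p) = (1 - 1 / c) * norm p"
      using c by (simp add: dist_norm)
    also have "\<dots> \<le> (c - 1) * M"
    proof (intro mult_mono)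
      have "0 \<le> (c - 1)\<^sup>2" by simp
      then show "1 - 1 / c \<le> c - 1" using c by (simp add: field_simps power2_eq_square)
    qed (use c M p in auto)
    finally show ?thesis by (simp add: mult.commute)
  qed
  ultimately show "p \<in> offset_nbhd (voronoi (lattice_of A)) (M * (2 * e + e\<^sup>2 + 2 * M * k * e))"
    by (auto simp: offset_nbhd_def c_def)
qed

lemma dH_le:
  assumes "0 \<le> r" "voronoi L \<subseteq> offset_nbhd (voronoi L') r" "voronoi L' \<subseteq> offset_nbhd (voronoi L) r"
  shows "dH L L' \<le> r"
proof -
  have "r \<in> offset_set L L'" "r \<in> offset_set L' L"
    using assms SO_mat_1 by (auto simp: offset_set_def intro!: bexI[of _ "mat 1"])
  then show ?thesis by (simp add: dH_def lattice_offset_le)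
qed

lemma dH_lattice_of_small:
  fixes B :: "real^'n^'n"
  assumes "invertible B" "0 < \<epsilon>"
  obtains \<delta> where "0 < \<delta>"
    "\<And>C. invertible C \<Longrightarrow> dist C B < \<delta> \<Longrightarrow> dH (lattice_of C) (lattice_of B) < \<epsilon>"
proof -
  obtain c where c: "c > 0" "\<And>x. norm x \<le> c * norm (B *v x)"
    using invertible_norm_bound[OF assms(1)] by blast
  \<comment> \<open>Doubling \<open>c\<close> leaves room for \<open>k\<close> to serve every
    \<open>C\<close> near \<open>B\<close> as well; likewise the \<open>+ 1\<close> in
    \<open>M\<close> covers \<open>norm C\<close>. \<open>K\<close> is the resulting Lipschitz
    constant at \<open>B\<close>.\<close>
  define k where "k = 2 * c"
  define M where "M = (norm B + 1) * CARD('n)"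
  define K where "K = M * (2 * k + k\<^sup>2 + 2 * M * k * k)"
  \<comment> \<open>The bound 1 controls \<open>norm C\<close> and the quadratic term,
    \<open>1 / k\<close> keeps \<open>C\<close> bounded below, and \<open>K + 1\<close> avoids
    division by zero.\<close>
  define \<delta> where "\<delta> = min (min 1 (1 / k)) (\<epsilon> / (K + 1))"
  have k: "0 < k" and M: "0 \<le> M" using c by (simp_all add: k_def M_def)
  then have K: "0 \<le> K" by (simp add: K_def)
  show ?thesis
  proof (rule that[of \<delta>])
    show "0 < \<delta>" using k K assms(2) by (simp add: \<delta>_def)
    fix C :: "real^'n^'n" assume C: "invertible C" "dist C B < \<delta>"
    define d where "d = norm (C - B)"
    have d: "0 \<le> d" "d \<le> 1" "d \<le> 1 / k" "d < \<epsilon> / (K + 1)"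
      using C(2) by (auto simp: d_def \<delta>_def dist_norm)
    have kB: "norm x \<le> k * norm (B *v x)" for x
      by (rule order_trans[OF c(2)]) (use c(1) in \<open>simp add: k_def\<close>)
    have kC: "norm x \<le> k * norm (C *v x)" for x
    proof -
      have "norm (B *v x) \<le> norm (C *v x) + norm (C *v x - B *v x)"
        by (metis norm_minus_commute norm_triangle_sub)
      moreover have "norm (C *v x - B *v x) \<le> d * norm x"
        unfolding d_def by (metis matrix_vector_mult_diff_rdistrib norm_matrix_vector_mult_le)
      moreover have "d * norm x \<le> 1 / k * norm x" using d by (intro mult_right_mono) auto
      ultimately have "norm (B *v x) \<le> norm (C *v x) + 1 / k * norm x" by linarith
      then have "c * norm (B *v x) \<le> c * (norm (C *v x) + 1 / k * norm x)"
        using c(1) by (intro mult_left_mono) auto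
      \<comment> \<open>Since \<open>c / k = 1 / 2\<close>, half of \<open>norm x\<close> can be
        moved to the left-hand side.\<close>
      also have "\<dots> = c * norm (C *v x) + norm x / 2"
        using c(1) by (simp add: k_def field_simps)
      finally show ?thesis using c(2)[of x] by (simp add: k_def)
    qed
    have nC: "norm C \<le> norm B + 1"
      using d(2) norm_triangle_sub[of C B] by (simp add: d_def)
    have MB: "norm p \<le> M" if "p \<in> voronoi (lattice_of B)" for p
      by (rule order_trans[OF norm_voronoi_le[OF assms(1) that]]) (simp add: M_def)
    have MC: "norm p \<le> M" if "p \<in> voronoi (lattice_of C)" for p
      by (rule order_trans[OF norm_voronoi_le[OF C(1) that]]) (simp add: M_def nC)
    define r where "r = M * (2 * (k * d) + (k * d)\<^sup>2 + 2 * M * k * (k * d))"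
    have "0 \<le> r" using M k d by (simp add: r_def)
    then have "dH (lattice_of C) (lattice_of B) \<le> r"
      using voronoi_subset_offset_nbhd[of k B M C, OF less_imp_le[OF k] kB M MC]
        voronoi_subset_offset_nbhd[of k C M B, OF less_imp_le[OF k] kC M MB]
      by (intro dH_le) (simp_all add: r_def d_def norm_minus_commute[of B C])
    also have "r \<le> K * d"
    proof -
      have "d\<^sup>2 \<le> d" using d by (simp add: power2_eq_square mult_left_le)
      then have "k\<^sup>2 * d\<^sup>2 \<le> k\<^sup>2 * d" by (intro mult_left_mono) auto
      then have "2 * (k * d) + (k * d)\<^sup>2 + 2 * M * k * (k * d) \<le> (2 * k + k\<^sup>2 + 2 * M * k * k) * d"
        by (simp add: power_mult_distrib algebra_simps)
      then show ?thesis unfolding r_def K_def mult.assoc[of M _ d] using M by (rule mult_left_mono)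
    qed
    also have "K * d \<le> (K + 1) * d" using d(1) by (simp add: algebra_simps)
    also have "\<dots> < \<epsilon>" using d(4) K by (simp add: field_simps)
    finally show "dH (lattice_of C) (lattice_of B) < \<epsilon>" .
  qed
qed

lemma continuous_on_dH_lattice_of:
  "continuous_on {BB :: (real^'n^'n) \<times> (real^'n^'n). invertible (fst BB) \<and> invertible (snd BB)}
     (\<lambda>(B, B'). dH (lattice_of B) (lattice_of B'))"
  unfolding continuous_on_iff
proof (clarsimp)
  fix B B' :: "real^'n^'n" and \<epsilon> :: real
  assume inv: "invertible B" "invertible B'" and "0 < \<epsilon>"
  then have "0 < \<epsilon> / 2" by simp
  then obtain \<delta> \<delta>' where \<delta>: "0 < \<delta>"
      "\<And>C. invertible C \<Longrightarrow> dist C B < \<delta> \<Longrightarrow> dH (lattice_of C) (lattice_of B) < \<epsilon> / 2"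
    and \<delta>': "0 < \<delta>'"
      "\<And>C. invertible C \<Longrightarrow> dist C B' < \<delta>' \<Longrightarrow> dH (lattice_of C) (lattice_of B') < \<epsilon> / 2"
    using dH_lattice_of_small inv by metis
  show "\<exists>d>0. \<forall>C C'. invertible C \<and> invertible C' \<longrightarrow> dist (C, C') (B, B') < d \<longrightarrow>
      dist (dH (lattice_of C) (lattice_of C')) (dH (lattice_of B) (lattice_of B')) < \<epsilon>"
  proof (intro exI[of _ "min \<delta> \<delta>'"] conjI allI impI)
    fix C C' :: "real^'n^'n"
    assume C: "invertible C \<and> invertible C'" and d: "dist (C, C') (B, B') < min \<delta> \<delta>'"
    have "dist C B < \<delta>" "dist C' B' < \<delta>'"
      using d dist_fst_le[of "(C, C')" "(B, B')"] dist_snd_le[of "(C, C')" "(B, B')"] by auto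
    then have small: "dH (lattice_of C) (lattice_of B) < \<epsilon> / 2" "dH (lattice_of C') (lattice_of B') < \<epsilon> / 2"
      using \<delta> \<delta>' C by auto
    have fl: "full_lattice (lattice_of B)" "full_lattice (lattice_of B')"
      "full_lattice (lattice_of C)" "full_lattice (lattice_of C')"
      using inv C by (auto simp: full_lattice_def)
    \<comment> \<open>Replacing one lattice at a time costs less than \<open>\<epsilon> / 2\<close>
      each, in both directions.\<close>
    have "dH (lattice_of C) (lattice_of C') \<le>
        dH (lattice_of C) (lattice_of B) + dH (lattice_of B) (lattice_of B') + dH (lattice_of B') (lattice_of C')"
      using dH_triangle[OF fl(3,1,4)] dH_triangle[OF fl(1,2,4)] by linarith
    moreover have "dH (lattice_of B) (lattice_of B') \<le>
        dH (lattice_of B) (lattice_of C) + dH (lattice_of C) (lattice_of C') + dH (lattice_of C') (lattice_of B')"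
      using dH_triangle[OF fl(1,3,2)] dH_triangle[OF fl(3,4,2)] by linarith
    ultimately show "dist (dH (lattice_of C) (lattice_of C')) (dH (lattice_of B) (lattice_of B')) < \<epsilon>"
      using small dH_commute[of "lattice_of B"] dH_commute[of "lattice_of B'" "lattice_of C'"]
      by (simp add: dist_real_def abs_less_iff)
  qed (use \<delta> \<delta>' in simp)
qed

text \<open>The first conjunct states that the infimum is a minimum. Independence of bases is built
  into the types: \<open>dH\<close> takes point sets, and matrices enter only through
  \<open>lattice_of\<close>.\<close>

theorem theorem2:
  fixes L L' L'' :: "(real^'n) set"
  shows
    "(full_lattice L \<and> full_lattice L' \<longrightarrow>
        lattice_offset L L' \<in> offset_set L L')
   \<and> (full_lattice L \<and> full_lattice L' \<longrightarrow>
        dH L L' \<ge> 0 \<and> (dH L L' = 0 \<longleftrightarrow> lattice_equiv L L'))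
   \<and> (full_lattice L \<and> full_lattice L' \<longrightarrow> dH L L' = dH L' L)
   \<and> (full_lattice L \<and> full_lattice L' \<and> full_lattice L'' \<longrightarrow>
        dH L L' + dH L' L'' \<ge> dH L L'')
   \<and> continuous_on {BB :: (real^'n^'n) \<times> (real^'n^'n). invertible (fst BB) \<and> invertible (snd BB)}
        (\<lambda>(B, B'). dH (lattice_of B) (lattice_of B'))"
  by (intro conjI impI; (elim conjE)?)
     (rule lattice_offset_attained dH_nonneg dH_eq_0_iff dH_commute dH_triangle
       continuous_on_dH_lattice_of | assumption)+

end
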